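(* Let $\Delta$ be a simplicial complex with at least one vertex, with facets $A_1,\dots,A_r$, and let $d$ be the maximum cardinality of a facet of $\Delta$. Then for every integer $i\ge 0$, $$f_i(\Delta)=\sum_{j=i+1}^{d}\binom{j-1}{i}\,\chi(N_j(\Delta)).$$
   Context: $f_i(\Delta)$ denotes the number of $i$-dimensional faces (faces of cardinality $i+1$) of $\Delta$. For an integer $j$, $N_j(\Delta)=\{F\subseteq[r] : |\bigcap_{l\in F}A_l|\ge j\}$ is the $j$-th nerve complex of $\Delta$, a simplicial complex on $[r]$. $\chi$ denotes the (unreduced) Euler characteristic, $\chi(K)=\sum_{h\ge 0}(-1)^h\#\{h\text{-dimensional faces of }K\}$. *)

theory Defs
  imports Main
begin

text \<open>
  Complexes are finite families of finite sets containing the empty set as a face whenever they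
  are non-void; the void family is permitted, since it occurs as a nerve complex for large \<open>j\<close>.
\<close>

definition abstract_simplicial_complex :: "'a set set \<Rightarrow> bool" where
  "abstract_simplicial_complex K \<longleftrightarrow>
     finite K \<and> (\<forall>F\<in>K. finite F) \<and> (\<forall>F\<in>K. \<forall>G. G \<subseteq> F \<longrightarrow> G \<in> K)"

definition vertices :: "'a set set \<Rightarrow> 'a set" where
  "vertices K = {v. {v} \<in> K}"

definition facets :: "'a set set \<Rightarrow> 'a set set" where
  "facets K = {F \<in> K. \<forall>G\<in>K. F \<subseteq> G \<longrightarrow> G = F}"

definition face_number :: "nat \<Rightarrow> 'a set set \<Rightarrow> nat" where
  "face_number i K = card {F \<in> K. card F = i + 1}"

text \<open>
  Unreduced: the empty face is not counted. Cutting the sum off at the number of vertices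
  only omits zero terms, because an \<open>h\<close>-dimensional face has \<open>h + 1\<close> vertices.
\<close>

definition euler_characteristic :: "'a set set \<Rightarrow> int" where
  "euler_characteristic K = (\<Sum>h<card (vertices K). (- 1) ^ h * int (face_number h K))"

text \<open>
  The facets are \<open>A 1, \<dots>, A r\<close>. The intersection is taken inside their union (the vertex set), so
  that the empty intersection, which HOL makes \<open>UNIV\<close>, is the vertex set instead. This only affects
  whether \<open>{}\<close> is a face.
\<close>

definition nerve_complex :: "nat \<Rightarrow> (nat \<Rightarrow> 'a set) \<Rightarrow> int \<Rightarrow> nat set set" where
  "nerve_complex r A j =
     {F. F \<subseteq> {1..r} \<and> int (card ((\<Union>l\<in>{1..r}. A l) \<inter> (\<Inter>l\<in>F. A l))) \<ge> j}"

lemma abstract_simplicial_complex_nerve_complex: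
  assumes "\<And>l. l \<in> {1..r} \<Longrightarrow> finite (A l)"
  shows "abstract_simplicial_complex (nerve_complex r A j)"
proof -
  let ?V = "\<Union>l\<in>{1..r}. A l"
  have V: "finite ?V" using assms by blast
  have "nerve_complex r A j \<subseteq> Pow {1..r}" by (auto simp: nerve_complex_def)
  then have fin: "finite (nerve_complex r A j)" by (rule finite_subset) simp
  have "G \<in> nerve_complex r A j" if F: "F \<in> nerve_complex r A j" and GF: "G \<subseteq> F" for F G
  proof -
    have "card (?V \<inter> (\<Inter>l\<in>F. A l)) \<le> card (?V \<inter> (\<Inter>l\<in>G. A l))"
      using V GF by (intro card_mono) auto
    then show ?thesis using F GF by (auto simp: nerve_complex_def)
  qed
  moreover have "finite F" if "F \<in> nerve_complex r A j" for F
    using that finite_subset[of F "{1..r}"] by (auto simp: nerve_complex_def)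
  ultimately show ?thesis using fin by (auto simp: abstract_simplicial_complex_def)
qed

end

theory Submission
  imports Defs
begin

text \<open>
  Summation on the upper index turns \<open>\<Sum>\<^sub>j (j - 1 choose i) \<chi>(N\<^sub>j)\<close> into the alternating sum, over
  the nonempty sets \<open>F\<close> of facet indices, of \<open>m choose (i + 1)\<close>, where \<open>m\<close> is the size of the
  intersection of the facets indexed by \<open>F\<close>. That binomial coefficient counts the \<open>i\<close>-faces common
  to these facets, so the alternating sum is the inclusion-exclusion formula for the set of all
  \<open>i\<close>-faces, as the union over the facets of their sets of \<open>i\<close>-faces.
\<close>

text \<open>Group the nonempty faces by dimension. The exponent \<open>card F + 1\<close> has the
  parity of the dimension \<open>card F - 1\<close> and avoids truncated subtraction.\<close>

lemma euler_characteristic_eq_sum_faces: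
  assumes K: "abstract_simplicial_complex K"
  shows "euler_characteristic K = (\<Sum>F | F \<in> K \<and> F \<noteq> {}. (- 1) ^ (card F + 1))"
proof -
  let ?K = "{F \<in> K. F \<noteq> {}}" and ?n = "card (vertices K)"
  have fin: "finite K" "\<And>F. F \<in> K \<Longrightarrow> finite F" and down: "\<And>F G. F \<in> K \<Longrightarrow> G \<subseteq> F \<Longrightarrow> G \<in> K"
    using K by (auto simp: abstract_simplicial_complex_def)
  have "vertices K \<subseteq> \<Union> K" by (auto simp: vertices_def)
  then have finV: "finite (vertices K)" using fin by (meson finite_Union finite_subset)
  \<comment> \<open>A face consists of vertices, so its dimension lies in the range of the grouped
    sum.\<close>
  have "card F - 1 < ?n" if F: "F \<in> ?K" for F
  proof -
    have "F \<subseteq> vertices K" using F down[of F] by (auto simp: vertices_def)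
    then have "card F \<le> ?n" using finV by (rule card_mono[rotated])
    moreover have "card F > 0" using F fin by (simp add: card_gt_0_iff)
    ultimately show ?thesis by simp
  qed
  then have "(\<Sum>F\<in>?K. (- 1) ^ (card F + 1)) =
      (\<Sum>h<?n. \<Sum>F | F \<in> ?K \<and> card F - 1 = h. (- 1 :: int) ^ (card F + 1))"
    using fin by (intro sum.group[symmetric]) auto
  also have "\<dots> = (\<Sum>h<?n. (- 1) ^ h * int (face_number h K))"
  proof (rule sum.cong[OF refl])
    fix h
    \<comment> \<open>Truncated subtraction would place the empty face at \<open>h = 0\<close>;
      nonemptiness excludes it.\<close>
    have "F \<in> ?K \<and> card F - 1 = h \<longleftrightarrow> F \<in> K \<and> card F = h + 1" for F
    proof (cases "F \<in> K")
      case True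
      then have "F = {} \<longleftrightarrow> card F = 0" using fin by simp
      with True show ?thesis by auto
    qed simp
    then have "{F \<in> ?K. card F - 1 = h} = {F \<in> K. card F = h + 1}" by blast
    then show "(\<Sum>F | F \<in> ?K \<and> card F - 1 = h. (- 1 :: int) ^ (card F + 1)) =
        (- 1) ^ h * int (face_number h K)"
      by (simp add: face_number_def mult.commute)
  qed
  finally show ?thesis by (simp add: euler_characteristic_def)
qed

text \<open>The hockey-stick identity. The test \<open>j \<le> m\<close> will express that an index
  set is a face of the \<open>j\<close>-th nerve; since \<open>m \<le> d\<close>, stopping at
  \<open>d\<close> loses nothing.\<close>

lemma sum_choose_upper_truncated:
  assumes "m \<le> d"
  shows "(\<Sum>j = i + 1..d. if j \<le> m then (j - 1) choose i else 0) = m choose (i + 1)"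
proof -
  have "(\<Sum>j = i + 1..d. if j \<le> m then (j - 1) choose i else 0) = (\<Sum>j = i + 1..m. (j - 1) choose i)"
    using assms by (intro sum.mono_neutral_cong_right) auto
  \<comment> \<open>The added terms have \<open>j - 1 < i\<close> and vanish. Starting at 1 matters:
    for \<open>i = 0\<close> the index \<open>j = 0\<close> would contribute
    \<open>0 choose 0 = 1\<close>.\<close>
  also have "\<dots> = (\<Sum>j = 1..m. (j - 1) choose i)"
    by (intro sum.mono_neutral_left) (auto simp: binomial_eq_0)
  also have "\<dots> = (\<Sum>k<m. k choose i)"
    by (rule sum.reindex_bij_witness[of _ Suc "\<lambda>j. j - 1"]) auto
  also have "\<dots> = m choose (i + 1)"
    by (cases m) (simp_all add: lessThan_Suc_atMost sum_choose_upper)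
  finally show ?thesis .
qed

lemma face_subset_facet:
  assumes "finite K" "F \<in> K"
  obtains G where "G \<in> facets K" "F \<subseteq> G"
proof -
  obtain G where "G \<in> K" "F \<subseteq> G" "\<forall>H\<in>K. G \<subseteq> H \<longrightarrow> G = H"
    using finite_has_maximal2[OF assms] by blast
  then have "G \<in> facets K" unfolding facets_def by blast
  with \<open>F \<subseteq> G\<close> show thesis by (rule that[rotated])
qed

text \<open>By finiteness each face lies in a maximal one, and by downward closure each subset of a
  facet is a face.\<close>

lemma face_number_eq_card_UN:
  assumes K: "abstract_simplicial_complex K" and A: "A ` I = facets K"
  shows "face_number i K = card (\<Union>l\<in>I. {S. S \<subseteq> A l \<and> card S = i + 1})"
proof -
  have fin: "finite K" and down: "\<And>F G. F \<in> K \<Longrightarrow> G \<subseteq> F \<Longrightarrow> G \<in> K"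
    using K by (auto simp: abstract_simplicial_complex_def)
  have AK: "A l \<in> K" if "l \<in> I" for l
    using that A by (auto simp: facets_def)
  have "\<exists>l\<in>I. S \<subseteq> A l" if "S \<in> K" for S
    using face_subset_facet[OF fin that] A by (metis imageE)
  then have "{S \<in> K. card S = i + 1} = (\<Union>l\<in>I. {S. S \<subseteq> A l \<and> card S = i + 1})"
    by (auto intro: down[OF AK])
  then show ?thesis by (simp add: face_number_def)
qed

lemma card_UN_n_subsets:
  assumes "finite I" "\<And>l. l \<in> I \<Longrightarrow> finite (A l)"
  shows "int (card (\<Union>l\<in>I. {S. S \<subseteq> A l \<and> card S = k})) =
    (\<Sum>F | F \<subseteq> I \<and> F \<noteq> {}. (- 1) ^ (card F + 1) * int (card (\<Inter>l\<in>F. A l) choose k))"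
proof -
  interpret Incl_Excl finite "int \<circ> card"
    by standard (auto simp: card_Un_disjnt)
  have "int (card (\<Inter>l\<in>F. {S. S \<subseteq> A l \<and> card S = k})) = int (card (\<Inter>l\<in>F. A l) choose k)"
    if F: "F \<subseteq> I" "F \<noteq> {}" for F
  proof -
    \<comment> \<open>A set lies in every \<open>A l\<close> iff it lies in their intersection; the
      cardinality condition survives because \<open>F\<close> is nonempty.\<close>
    have "(\<Inter>l\<in>F. {S. S \<subseteq> A l \<and> card S = k}) = {S. S \<subseteq> (\<Inter>l\<in>F. A l) \<and> card S = k}"
      using F by auto
    moreover have "finite (\<Inter>l\<in>F. A l)" using F assms(2) by blast
    ultimately show ?thesis by (simp only: n_subsets)
  qed
  then show ?thesis
    using restricted_indexed[of I "\<lambda>l. {S. S \<subseteq> A l \<and> card S = k}"] assms by auto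
qed

text \<open>Membership in the nerve becomes a condition on the summand, so the range of
  \<open>F\<close> no longer depends on \<open>j\<close> and the two sums can later be
  swapped.\<close>

lemma euler_characteristic_nerve_complex:
  assumes "\<And>l. l \<in> {1..r} \<Longrightarrow> finite (A l)"
  shows "euler_characteristic (nerve_complex r A (int j)) =
    (\<Sum>F | F \<subseteq> {1..r} \<and> F \<noteq> {}. if j \<le> card (\<Inter>l\<in>F. A l) then (- 1) ^ (card F + 1) else 0)"
proof -
  \<comment> \<open>For nonempty \<open>F\<close> the intersection already lies in the union of the
    facets.\<close>
  have "(\<Union>l\<in>{1..r}. A l) \<inter> (\<Inter>l\<in>F. A l) = (\<Inter>l\<in>F. A l)" if "F \<subseteq> {1..r}" "F \<noteq> {}" for F
    using that by blast
  then have "{F \<in> nerve_complex r A (int j). F \<noteq> {}} =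
      {F \<in> {F. F \<subseteq> {1..r} \<and> F \<noteq> {}}. j \<le> card (\<Inter>l\<in>F. A l)}"
    unfolding nerve_complex_def mem_Collect_eq of_nat_le_iff
    by (intro Collect_cong) (metis (no_types, lifting))
  moreover have "finite {F. F \<subseteq> {1..r} \<and> F \<noteq> {}}" by simp
  ultimately show ?thesis
    by (simp only: sum.inter_filter assms abstract_simplicial_complex_nerve_complex
        euler_characteristic_eq_sum_faces)
qed

theorem theorem6p1:
  fixes \<Delta> :: "'a set set" and A :: "nat \<Rightarrow> 'a set" and r d i :: nat
  assumes "abstract_simplicial_complex \<Delta>"
    and "vertices \<Delta> \<noteq> {}"
    and "bij_betw A {1..r} (facets \<Delta>)"
    and "d = Max (card ` facets \<Delta>)"
  shows "int (face_number i \<Delta>) =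
    (\<Sum>j = i + 1..d. int ((j - 1) choose i) * euler_characteristic (nerve_complex r A (int j)))"
proof -
  let ?N = "{F. F \<subseteq> {1..r} \<and> F \<noteq> {}}" and ?m = "\<lambda>F. card (\<Inter>l\<in>F. A l)"
  have img: "A ` {1..r} = facets \<Delta>" using assms(3) by (rule bij_betw_imp_surj_on)
  have finA: "finite (A l)" if "l \<in> {1..r}" for l
    using that img assms(1) by (auto simp: facets_def abstract_simplicial_complex_def)
  have finF: "finite (card ` facets \<Delta>)" by (simp flip: img)
  \<comment> \<open>The intersection is contained in any one facet indexed by
    \<open>F\<close>.\<close>
  have le: "?m F \<le> d" if F: "F \<in> ?N" for F
  proof -
    obtain l where l: "l \<in> F" "l \<in> {1..r}" using F by blast
    then have "?m F \<le> card (A l)" using finA by (intro card_mono) auto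
    also have "\<dots> \<le> d" using l img finF by (auto simp: assms(4) intro!: Max_ge)
    finally show ?thesis .
  qed
  \<comment> \<open>The condition on \<open>j\<close> moves from the sign to the binomial
    coefficient, so that the sign factors out of the inner sum after the swap.\<close>
  have "(\<Sum>j = i + 1..d. int ((j - 1) choose i) * euler_characteristic (nerve_complex r A (int j))) =
      (\<Sum>j = i + 1..d. \<Sum>F\<in>?N. (- 1) ^ (card F + 1) * int (if j \<le> ?m F then (j - 1) choose i else 0))"
    by (simp only: euler_characteristic_nerve_complex finA sum_distrib_left)
      (intro sum.cong refl, simp)
  also have "\<dots> = (\<Sum>F\<in>?N. (- 1) ^ (card F + 1) *
      int (\<Sum>j = i + 1..d. if j \<le> ?m F then (j - 1) choose i else 0))"
    by (subst sum.swap) (simp only: sum_distrib_left of_nat_sum)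
  also have "\<dots> = (\<Sum>F\<in>?N. (- 1) ^ (card F + 1) * int (?m F choose (i + 1)))"
    using le by (intro sum.cong refl) (simp only: sum_choose_upper_truncated)
  also have "\<dots> = int (face_number i \<Delta>)"
    using card_UN_n_subsets[of "{1..r}" A] finA face_number_eq_card_UN[OF assms(1) img] by simp
  finally show ?thesis by simp
qed

end
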